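(* Let $l\geq 1$ be an integer. For every integer $n\geq 1$, the super-Eulerian polynomial $E_n^{(l)}(t)$ has only nonpositive real zeros. Moreover, $$E_n^{(l)}\preceq E_{n+1}^{(l)}.$$ The gamma-polynomial of $E_n^{(l)}$ is real-rooted and has nonnegative coefficients.
   Context: Fix an integer $l\geq 1$. Define numbers $E_{n,k}^{(l)}$ by $E_{1,0}^{(l)}=1$ and, for $n\geq 2$ and $0\leq k\leq n-1$, $$E_{n,k}^{(l)}=(k+1)^l E_{n-1,k}^{(l)}+(n-k)^l E_{n-1,k-1}^{(l)},$$ where entries $E_{n,k}^{(l)}$ with $k$ outside $0\leq k\leq n-1$ are zero. The super-Eulerian polynomial is $E_n^{(l)}(t)=\sum_{k=0}^{n-1}E_{n,k}^{(l)}t^k$. It is known that $E_n^{(l)}$ is palindromic of degree $n-1$ (i.e. $E_{n,k}^{(l)}=E_{n,n-1-k}^{(l)}$), so there is a unique expansion $$E_n^{(l)}(t)=\sum_{i=0}^{\lfloor (n-1)/2\rfloor}\gamma_{n,i}^{(l)}\,t^i(1+t)^{n-1-2i}.$$ The polynomial $\sum_i\gamma_{n,i}^{(l)}t^i$ is called the gamma-polynomial of $E_n^{(l)}$. A polynomial is real-rooted if all its complex zeros are real (nonzero constants are real-rooted). For nonzero real-rooted polynomials $g,f$ with positive leading coefficients, $g\preceq f$ means that $\deg f-\deg g\in\{0,1\}$ and the roots alternate as follows: if $g$ is constant there is no further condition; otherwise, with $d=\deg g\geq 1$, roots $u_1\geq\cdots\geq u_d$ of $g$ and roots $v_1\geq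 v_2\geq\cdots$ of $f$ listed with multiplicity, $v_1\geq u_1\geq v_2\geq\cdots\geq u_d\geq v_{d+1}$ if $\deg f=d+1$, and $v_1\geq u_1\geq v_2\geq\cdots\geq v_d\geq u_d$ if $\deg f=d$. *)

theory Defs
  imports Complex_Main "HOL-Computational_Algebra.Computational_Algebra"
begin

text \<open>
  The recursion starts at \<open>n = 1\<close>; the row \<open>n = 0\<close> is a junk value. Entries with \<open>k \<ge> n\<close> are zero,
  and the inner conditional says that the entry with index \<open>k - 1 = -1\<close> is zero. The subtraction
  is only evaluated for \<open>k < n\<close>, so it never truncates.
\<close>

fun super_eulerian :: "nat \<Rightarrow> nat \<Rightarrow> nat \<Rightarrow> nat" where
  "super_eulerian l 0 k = 0"
| "super_eulerian l (Suc 0) k = (if k = 0 then 1 else 0)"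
| "super_eulerian l (Suc (Suc m)) k =
    (if k < Suc (Suc m)
     then (k + 1) ^ l * super_eulerian l (Suc m) k
        + (Suc (Suc m) - k) ^ l * (if k = 0 then 0 else super_eulerian l (Suc m) (k - 1))
     else 0)"

definition super_eulerian_poly :: "nat \<Rightarrow> nat \<Rightarrow> real poly" where
  "super_eulerian_poly l n = (\<Sum>k<n. monom (real (super_eulerian l n k)) k)"

text \<open>
  The polynomial \<open>g\<close> collects the coefficients of the expansion of \<open>p\<close> in the basis
  \<open>t^i (1 + t)^(d - 2 i)\<close>, \<open>0 \<le> i \<le> d div 2\<close>, of the palindromic polynomials with centre
  \<open>d / 2\<close>. Such a \<open>g\<close> is unique if it exists, and it exists if \<open>p\<close> is palindromic
  (\<open>coeff p k = coeff p (d - k)\<close>) of degree at most \<open>d\<close>.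
\<close>

definition gamma_expansion :: "nat \<Rightarrow> real poly \<Rightarrow> real poly \<Rightarrow> bool" where
  "gamma_expansion d p g \<longleftrightarrow>
     degree g \<le> d div 2 \<and>
     p = (\<Sum>i=0..d div 2. smult (coeff g i) (monom 1 i * [:1, 1:] ^ (d - 2 * i)))"

definition gamma_poly :: "nat \<Rightarrow> real poly \<Rightarrow> real poly" where
  "gamma_poly d p = (THE g. gamma_expansion d p g)"

definition complex_zeros :: "real poly \<Rightarrow> complex set" where
  "complex_zeros p = {z. poly (map_poly complex_of_real p) z = 0}"

text \<open>The zero polynomial is not real-rooted.\<close>

definition real_rooted :: "real poly \<Rightarrow> bool" where
  "real_rooted p \<longleftrightarrow> complex_zeros p \<subseteq> \<real>"

text \<open>
  The real roots, with multiplicity, in weakly decreasing order. For a nonzero real-rooted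
  polynomial the length of this list is the degree.
\<close>

definition roots_desc :: "real poly \<Rightarrow> real list" where
  "roots_desc p = rev (sorted_list_of_multiset (proots p))"

text \<open>
  With \<open>u ! i\<close> the root \<open>u\<^sub>i\<^sub>+\<^sub>1\<close> of \<open>g\<close> and \<open>v ! i\<close> the root \<open>v\<^sub>i\<^sub>+\<^sub>1\<close> of \<open>f\<close>, the last two
  conjuncts give \<open>v\<^sub>1 \<ge> u\<^sub>1 \<ge> v\<^sub>2 \<ge> u\<^sub>2 \<ge> \<dots>\<close>, ending with \<open>u\<^sub>d \<ge> v\<^sub>d\<^sub>+\<^sub>1\<close> if \<open>degree f = d + 1\<close>
  and with \<open>v\<^sub>d \<ge> u\<^sub>d\<close> if \<open>degree f = d\<close>. Both are void if \<open>g\<close> is constant.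
\<close>

definition interlaces :: "real poly \<Rightarrow> real poly \<Rightarrow> bool" (infix "\<preceq>" 50) where
  "g \<preceq> f \<longleftrightarrow>
     g \<noteq> 0 \<and> f \<noteq> 0 \<and> real_rooted g \<and> real_rooted f \<and>
     lead_coeff g > 0 \<and> lead_coeff f > 0 \<and>
     (degree f = degree g \<or> degree f = degree g + 1) \<and>
     (let u = roots_desc g; v = roots_desc f in
        (\<forall>i<degree g. v ! i \<ge> u ! i) \<and>
        (\<forall>i. i + 1 < degree f \<longrightarrow> u ! i \<ge> v ! (i + 1)))"

end

theory Submission
  imports Defs
begin

text \<open>
  The numbers \<open>R\<^sub>n\<^sub>,\<^sub>k = ((k + 1)! (n - k)!)^l E\<^sub>n\<^sub>,\<^sub>k\<close> satisfy
  \<open>R\<^sub>n\<^sub>+\<^sub>1\<^sub>,\<^sub>k = ((k + 1) (n + 1 - k))^l (R\<^sub>n\<^sub>,\<^sub>k + R\<^sub>n\<^sub>,\<^sub>k\<^sub>-\<^sub>1)\<close>. On complex polynomials of degree at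
  most \<open>n\<close>, multiplying the \<open>k\<close>-th coefficient by \<open>k + 1\<close>, \<open>n + 1 - k\<close>, \<open>1 / (k + 1)!\<close> or
  \<open>1 / (n + 1 - k)!\<close> preserves the property that all zeros lie in a closed half-plane bounded by the
  real line. Hence \<open>R\<^sub>n\<close> and \<open>E\<^sub>n\<close> are real-rooted.

  Applying the same multipliers to \<open>(1 + \<i> + t) R\<^sub>n\<close> instead of \<open>(1 + t) R\<^sub>n\<close> shows that
  \<open>E\<^sub>n\<^sub>+\<^sub>1 + \<i> A^l E\<^sub>n\<close> has no zeros in the upper half-plane, where \<open>A f = (t f)'\<close>. The same holds for
  \<open>A f + \<i> f\<close> if \<open>f\<close> has only nonpositive zeros. By a Hermite--Biehler argument the \<open>i\<close>-th largest zeros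
  of \<open>E\<^sub>n\<close>, \<open>A E\<^sub>n\<close>, ..., \<open>A^l E\<^sub>n\<close>, \<open>E\<^sub>n\<^sub>+\<^sub>1\<close> therefore increase, which is one half of interlacing. The
  zeros of a palindromic polynomial are closed under inversion, and inversion turns this half
  into the other one.

  For the gamma-polynomial, pair the zeros \<open>r\<close> and \<open>1 / r\<close>: the product of their linear factors
  is \<open>(1 + t)^2 + s t\<close> with \<open>s \<ge> 0\<close>, and contributes the factor \<open>1 + s t\<close>.
\<close>

subsection \<open>Complex polynomials with zeros in a half-plane\<close>

text \<open>The zeros lie in the closed lower half-plane for \<open>\<sigma> > 0\<close>, in the closed upper one for \<open>\<sigma> < 0\<close>.\<close>

definition halfplane_stable :: "real \<Rightarrow> complex poly \<Rightarrow> bool" where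
  "halfplane_stable \<sigma> F \<longleftrightarrow> F \<noteq> 0 \<and> (\<forall>z. poly F z = 0 \<longrightarrow> \<sigma> * Im z \<le> 0)"

lemma stable_const [simp]: "halfplane_stable \<sigma> [:a:] \<longleftrightarrow> a \<noteq> 0"
  by (auto simp: halfplane_stable_def)

lemma stable_mult [simp]: "halfplane_stable \<sigma> (F * G) \<longleftrightarrow> halfplane_stable \<sigma> F \<and> halfplane_stable \<sigma> G"
  by (auto simp: halfplane_stable_def)

lemma stable_linear [simp]: "halfplane_stable \<sigma> [:a, 1:] \<longleftrightarrow> 0 \<le> \<sigma> * Im a"
proof -
  have "poly [:a, 1:] z = 0 \<longleftrightarrow> z = - a" for z
    by (auto simp: add_eq_0_iff)
  then show ?thesis
    by (auto simp: halfplane_stable_def)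
qed

lemma stable_smult [simp]: "halfplane_stable \<sigma> (smult c F) \<longleftrightarrow> c \<noteq> 0 \<and> halfplane_stable \<sigma> F"
  by (auto simp: halfplane_stable_def)

text \<open>The fundamental theorem of algebra lets one root be split off at a time. The set
  \<open>A\<close> travels along, so the location of the roots stays available in every induction
  step.\<close>

lemma complex_poly_roots_induct [consumes 2, case_names const linear]:
  fixes F :: "complex poly"
  assumes "F \<noteq> 0" "{z. poly F z = 0} \<subseteq> A"
    and const: "\<And>a. a \<noteq> 0 \<Longrightarrow> P [:a:]"
    and linear: "\<And>r G. r \<in> A \<Longrightarrow> G \<noteq> 0 \<Longrightarrow> {z. poly G z = 0} \<subseteq> A \<Longrightarrow> P G \<Longrightarrow>
      P ([:- r, 1:] * G)"
  shows "P F"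
  using assms(1,2)
proof (induction "degree F" arbitrary: F)
  case 0
  then obtain a where "F = [:a:]"
    by (metis degree_eq_zeroE)
  then show ?case
    using 0 const by simp
next
  case (Suc n)
  have "\<not> constant (poly F)"
    using Suc.hyps(2) by (simp add: constant_degree)
  then obtain r where r: "poly F r = 0"
    using fundamental_theorem_of_algebra by blast
  then obtain G where G: "F = [:- r, 1:] * G"
    by (auto simp: poly_eq_0_iff_dvd dvd_def)
  have "G \<noteq> 0"
    using Suc.prems(1) G by auto
  moreover from this have "degree F = Suc (degree G)"
    unfolding G by (subst degree_mult_eq) auto
  moreover have "{z. poly G z = 0} \<subseteq> A"
    using Suc.prems(2) unfolding G poly_mult by auto
  ultimately have "P ([:- r, 1:] * G)"
    using Suc r by (intro linear) auto
  then show ?case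
    unfolding G .
qed

lemma halfplane_stable_induct [consumes 1, case_names const linear]:
  assumes "halfplane_stable \<sigma> F"
    and "\<And>a. a \<noteq> 0 \<Longrightarrow> P [:a:]"
    and "\<And>r G. \<sigma> * Im r \<le> 0 \<Longrightarrow> halfplane_stable \<sigma> G \<Longrightarrow> P G \<Longrightarrow> P ([:- r, 1:] * G)"
  shows "P F"
  by (rule complex_poly_roots_induct[where A = "{z. \<sigma> * Im z \<le> 0}"])
    (use assms in \<open>auto simp: halfplane_stable_def subset_eq simp del: mult_pCons_left\<close>)

text \<open>The imaginary part of 1/w is - Im w / |w|^2.\<close>

lemma sgn_Im_inverse:
  fixes \<sigma> :: real
  assumes "\<sigma> * Im w > 0"
  shows "\<sigma> * Im (inverse w) < 0"
proof -
  have "Im w \<noteq> 0"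
    using assms by auto
  then have "(Re w)\<^sup>2 + (Im w)\<^sup>2 > 0"
    by (simp add: sum_power2_gt_zero_iff)
  then show ?thesis
    using assms by (simp add: divide_less_0_iff)
qed

lemma log_deriv_linear_mult:
  fixes G :: "complex poly"
  assumes "z \<noteq> r" "poly G z \<noteq> 0"
  shows "poly (pderiv ([:- r, 1:] * G)) z / poly ([:- r, 1:] * G) z =
    inverse (z - r) + poly (pderiv G) z / poly G z"
  using assms by (simp add: pderiv_mult pderiv_pCons field_simps del: mult_pCons_left mult_pCons_right)

text \<open>F'/F is the sum of 1/(z - r) over the roots r, and each summand has imaginary part of
  the same strict sign. The weak inequality covers constants and carries the induction; one root
  makes it strict.\<close>

lemma log_deriv_beyond_roots:
  fixes F :: "complex poly" and \<sigma> :: real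
  assumes "F \<noteq> 0" "{r. poly F r = 0} \<subseteq> {r. \<sigma> * Im r < \<sigma> * Im z}"
  shows "\<sigma> * Im (poly (pderiv F) z / poly F z) \<le> 0 \<and>
    (degree F > 0 \<longrightarrow> \<sigma> * Im (poly (pderiv F) z / poly F z) < 0)"
  using assms
proof (induction rule: complex_poly_roots_induct)
  case (linear r G)
  have "poly G z \<noteq> 0" "z \<noteq> r"
    using linear(1,3) by auto
  have "\<sigma> * Im (z - r) > 0"
    using linear by (simp add: algebra_simps)
  then have "\<sigma> * Im (inverse (z - r)) < 0"
    by (rule sgn_Im_inverse)
  then show ?case
    using linear.IH
    unfolding log_deriv_linear_mult[OF \<open>z \<noteq> r\<close> \<open>poly G z \<noteq> 0\<close>] plus_complex.sel distrib_left
    by linarith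
qed (simp add: pderiv_pCons)

lemma halfplane_stableI:
  assumes "\<sigma> \<noteq> 0" "\<And>z. \<sigma> * Im z > 0 \<Longrightarrow> poly F z \<noteq> 0"
  shows "halfplane_stable \<sigma> F"
proof -
  \<comment> \<open>A sample point of the open half-plane, where F does not vanish, rules out the
    zero polynomial.\<close>
  have "\<sigma> * Im (Complex 0 \<sigma>) > 0"
    using assms(1) by (simp flip: power2_eq_square)
  then have "F \<noteq> 0"
    using assms(2) by fastforce
  then show ?thesis
    using assms(2) by (force simp: halfplane_stable_def not_le)
qed

text \<open>At a zero of F' - r F in the open half-plane, F'/F would equal r, but the two have
  imaginary parts of incompatible signs. The case r = 0 is Gauss-Lucas.\<close>

lemma stable_pderiv_diff:
  assumes "halfplane_stable \<sigma> F" "degree F > 0" "0 \<le> \<sigma> * Im r" "\<sigma> \<noteq> 0"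
  shows "halfplane_stable \<sigma> (pderiv F - smult r F)"
proof (rule halfplane_stableI)
  fix z
  assume z: "\<sigma> * Im z > 0"
  show "poly (pderiv F - smult r F) z \<noteq> 0"
  proof
    assume "poly (pderiv F - smult r F) z = 0"
    moreover have "poly F z \<noteq> 0"
      using assms(1) z by (auto simp: halfplane_stable_def)
    ultimately have "poly (pderiv F) z / poly F z = r"
      by (simp add: field_simps)
    moreover have "{r. poly F r = 0} \<subseteq> {r. \<sigma> * Im r < \<sigma> * Im z}"
      using assms(1) z by (force simp: halfplane_stable_def)
    then have "\<sigma> * Im (poly (pderiv F) z / poly F z) < 0"
      using assms(1,2) log_deriv_beyond_roots[of F \<sigma> z] by (auto simp: halfplane_stable_def)
    ultimately show False
      using assms(3) by simp
  qed
qed (rule assms)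

lemma stable_pderiv: "halfplane_stable \<sigma> (pderiv F)"
  if "halfplane_stable \<sigma> F" "degree F > 0" "\<sigma> \<noteq> 0"
  using stable_pderiv_diff[of \<sigma> F 0] that by simp

subsection \<open>Coefficient multipliers that preserve stability\<close>

text \<open>This is t^N p(1/t) with a formal degree N. In contrast to \<open>reflect_poly\<close> it
  is an involution on all polynomials of degree at most N, whatever their extreme coefficients
  are.\<close>

definition coeff_rev :: "nat \<Rightarrow> 'a::comm_semiring_1 poly \<Rightarrow> 'a poly" where
  "coeff_rev N p = (\<Sum>k\<le>N. monom (coeff p (N - k)) k)"

lemma coeff_coeff_rev: "coeff (coeff_rev N p) k = (if k \<le> N then coeff p (N - k) else 0)"
  by (simp add: coeff_rev_def coeff_sum)

lemma degree_coeff_rev: "degree (coeff_rev N p) \<le> N"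
  by (rule degree_le) (simp add: coeff_coeff_rev)

lemma coeff_rev_coeff_rev: "degree p \<le> N \<Longrightarrow> coeff_rev N (coeff_rev N p) = p"
  by (rule poly_eqI) (auto simp: coeff_coeff_rev coeff_eq_0)

lemma coeff_rev_altdef:
  fixes p :: "'a::idom poly"
  assumes "degree p \<le> N"
  shows "coeff_rev N p = monom 1 (N - degree p) * reflect_poly p"
  by (rule poly_eqI)
    (use assms in \<open>auto simp: coeff_coeff_rev coeff_monom_mult coeff_reflect_poly coeff_eq_0\<close>)

text \<open>Inversion swaps the two half-planes, and zeros created at 0 lie on their common
  boundary.\<close>

lemma stable_coeff_rev:
  assumes "halfplane_stable \<sigma> F" "degree F \<le> N"
  shows "halfplane_stable (- \<sigma>) (coeff_rev N F)"
proof -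
  have "\<sigma> * Im z \<ge> 0" if "poly (coeff_rev N F) z = 0" for z
  proof (cases "z = 0")
    case False
    then have "poly F (inverse z) = 0"
      using that assms(2) by (simp add: coeff_rev_altdef poly_monom poly_reflect_poly_nz)
    then have "\<sigma> * Im (inverse z) \<le> 0"
      using assms(1) unfolding halfplane_stable_def by blast
    moreover have "(- \<sigma>) * Im z > 0 \<Longrightarrow> (- \<sigma>) * Im (inverse z) < 0"
      by (rule sgn_Im_inverse)
    ultimately show ?thesis
      by (force simp only: mult_minus_left)
  qed simp
  then show ?thesis
    using assms by (auto simp: halfplane_stable_def coeff_rev_altdef)
qed

definition hadamard :: "(nat \<Rightarrow> 'a::comm_semiring_1) \<Rightarrow> 'a poly \<Rightarrow> 'a poly" where
  "hadamard c p = (\<Sum>k\<le>degree p. monom (c k * coeff p k) k)"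

lemma coeff_hadamard: "coeff (hadamard c p) k = c k * coeff p k"
  by (simp add: hadamard_def coeff_sum coeff_eq_0)

lemma degree_hadamard_le: "degree (hadamard c p) \<le> degree p"
  by (rule degree_le) (simp add: coeff_hadamard coeff_eq_0)

text \<open>Both signs of \<sigma> are demanded because reversal swaps the half-planes. F is complex
  so that real pairs can be sent through a multiplier as q + i p.\<close>

definition stability_multiplier :: "nat \<Rightarrow> (nat \<Rightarrow> real) \<Rightarrow> bool" where
  "stability_multiplier N c \<longleftrightarrow>
    (\<forall>\<sigma> F. \<sigma> \<noteq> 0 \<longrightarrow> halfplane_stable \<sigma> F \<longrightarrow> degree F \<le> N \<longrightarrow>
      halfplane_stable \<sigma> (hadamard (\<lambda>k. complex_of_real (c k)) F))"

lemma stability_multiplierD: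
  "stability_multiplier N c \<Longrightarrow> \<sigma> \<noteq> 0 \<Longrightarrow> halfplane_stable \<sigma> F \<Longrightarrow> degree F \<le> N \<Longrightarrow>
    halfplane_stable \<sigma> (hadamard (\<lambda>k. complex_of_real (c k)) F)"
  by (simp add: stability_multiplier_def)

lemma stability_multiplier_cong:
  assumes "\<And>k. k \<le> N \<Longrightarrow> c k = d k"
  shows "stability_multiplier N c \<longleftrightarrow> stability_multiplier N d"
proof -
  have "hadamard (\<lambda>k. complex_of_real (c k)) F = hadamard (\<lambda>k. complex_of_real (d k)) F"
    if "degree F \<le> N" for F
    using assms that by (auto simp: hadamard_def intro!: sum.cong)
  then show ?thesis
    by (auto simp: stability_multiplier_def)
qed

lemma stability_multiplier_mult:
  assumes "stability_multiplier N c" "stability_multiplier N d"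
  shows "stability_multiplier N (\<lambda>k. c k * d k)"
proof -
  have "hadamard (\<lambda>k. complex_of_real (c k * d k)) F =
      hadamard (\<lambda>k. complex_of_real (c k)) (hadamard (\<lambda>k. complex_of_real (d k)) F)" for F
    by (rule poly_eqI) (simp add: coeff_hadamard)
  then show ?thesis
    using assms unfolding stability_multiplier_def
    by (metis degree_hadamard_le order_trans)
qed

lemma stability_multiplier_power:
  assumes "stability_multiplier N c"
  shows "stability_multiplier N (\<lambda>k. c k ^ l)"
proof (induction l)
  case 0
  have "hadamard (\<lambda>k. 1) F = F" for F :: "complex poly"
    by (rule poly_eqI) (simp add: coeff_hadamard)
  then show ?case
    by (simp add: stability_multiplier_def)
qed (use assms in \<open>simp add: stability_multiplier_mult\<close>)

text \<open>Conjugation by \<open>coeff_rev N\<close> swaps the half-planes twice.\<close>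

lemma stability_multiplier_rev:
  assumes "stability_multiplier N c"
  shows "stability_multiplier N (\<lambda>k. c (N - k))"
  unfolding stability_multiplier_def
proof (intro allI impI)
  fix \<sigma> F
  assume F: "\<sigma> \<noteq> (0::real)" "halfplane_stable \<sigma> F" "degree F \<le> N"
  let ?H = "hadamard (\<lambda>k. complex_of_real (c k)) (coeff_rev N F)"
  have "halfplane_stable (- \<sigma>) ?H"
    using F by (intro stability_multiplierD[OF assms] stable_coeff_rev degree_coeff_rev) auto
  moreover have "degree ?H \<le> N"
    using degree_hadamard_le degree_coeff_rev order_trans by blast
  ultimately have "halfplane_stable (- (- \<sigma>)) (coeff_rev N ?H)"
    by (rule stable_coeff_rev)
  also have "coeff_rev N ?H = hadamard (\<lambda>k. complex_of_real (c (N - k))) F"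
    using F(3) by (intro poly_eqI) (auto simp: coeff_coeff_rev coeff_hadamard coeff_eq_0)
  finally show "halfplane_stable \<sigma> (hadamard (\<lambda>k. complex_of_real (c (N - k))) F)"
    by simp
qed

section \<open>Concrete multipliers: linear factors and reciprocal factorials\<close>

lemma stability_multiplier_Suc: "stability_multiplier N (\<lambda>k. real (Suc k))"
proof -
  have "hadamard (\<lambda>k. complex_of_real (real (Suc k))) F = pderiv ([:0, 1:] * F)" for F
    by (rule poly_eqI) (simp add: coeff_hadamard coeff_pderiv del: of_nat_Suc)
  \<comment> \<open>The extra factor t has a real zero and makes the polynomial nonconstant, so
    Gauss-Lucas applies even if F is constant.\<close>
  moreover have "halfplane_stable \<sigma> (pderiv ([:0, 1:] * F))" if "halfplane_stable \<sigma> F" "\<sigma> \<noteq> 0" for \<sigma> F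
  proof (rule stable_pderiv)
    show "halfplane_stable \<sigma> ([:0, 1:] * F)"
      using that(1) by (subst stable_mult) simp
    show "degree ([:0, 1:] * F) > 0"
      using that(1) by (subst degree_mult_eq) (auto simp: halfplane_stable_def)
  qed (rule that)
  ultimately show ?thesis
    by (simp add: stability_multiplier_def)
qed

lemma stability_multiplier_rev_Suc: "stability_multiplier N (\<lambda>k. real (Suc N - k))"
  using stability_multiplier_rev[OF stability_multiplier_Suc[of N]]
  by (rule iffD1[OF stability_multiplier_cong, rotated]) (simp add: Suc_diff_le)

text \<open>
  Up to a factor, \<open>rev_laguerre K F\<close> is \<open>F(D) t^K\<close>. Multiplying \<open>F\<close> by \<open>t - r\<close>
  therefore applies \<open>D - r\<close>, which reduces the multiplier \<open>1 / (K - k)!\<close> to linear factors.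
\<close>

definition rev_laguerre :: "nat \<Rightarrow> complex poly \<Rightarrow> complex poly" where
  "rev_laguerre K F = coeff_rev K (hadamard (\<lambda>k. inverse (fact (K - k))) F)"

lemma coeff_rev_laguerre:
  "coeff (rev_laguerre K F) j = (if j \<le> K then coeff F (K - j) / fact j else 0)"
  by (simp add: rev_laguerre_def coeff_coeff_rev coeff_hadamard divide_inverse mult.commute)

lemma rev_laguerre_linear_mult:
  "rev_laguerre K ([:- r, 1:] * F) = pderiv (rev_laguerre K F) - smult r (rev_laguerre K F)"
proof (rule poly_eqI)
  fix j
  show "coeff (rev_laguerre K ([:- r, 1:] * F)) j =
    coeff (pderiv (rev_laguerre K F) - smult r (rev_laguerre K F)) j"
  proof (cases "j < K")
    case True
    then have "K - j = Suc (K - Suc j)"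
      by simp
    then show ?thesis
      using True by (simp add: coeff_rev_laguerre coeff_pderiv field_simps del: of_nat_Suc)
  qed (auto simp: coeff_rev_laguerre coeff_pderiv)
qed

text \<open>Induction on the linear factors of F, starting from a multiple of t^K. A root r of F
  lies in the half-plane on the side that \<open>stable_pderiv_diff\<close> requires for -
  \<sigma>.\<close>

lemma stable_rev_laguerre:
  assumes "\<sigma> \<noteq> 0" "halfplane_stable \<sigma> F" "degree F < K"
  shows "halfplane_stable (- \<sigma>) (rev_laguerre K F)"
  using assms(2,3)
proof (induction rule: halfplane_stable_induct)
  case (const a)
  have "rev_laguerre K [:a:] = smult (a / fact K) ([:0, 1:] ^ K)"
    by (rule poly_eqI) (auto simp: coeff_rev_laguerre coeff_pCons monom_altdef[of 1, simplified, symmetric]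
        split: nat.split)
  moreover have "halfplane_stable (- \<sigma>) ([:0, 1:] ^ K)"
    by (auto simp: halfplane_stable_def)
  ultimately show ?case
    using const by simp
next
  case (linear r G)
  have "G \<noteq> 0"
    using linear by (simp add: halfplane_stable_def)
  then have "degree ([:- r, 1:] * G) = Suc (degree G)"
    by (subst degree_mult_eq) auto
  then have deg: "degree G < K"
    using linear by simp
  \<comment> \<open>The leading coefficient of G lands at index K - \<open>degree G\<close> > 0, so
    the polynomial to be differentiated is not constant.\<close>
  then have "coeff (rev_laguerre K G) (K - degree G) \<noteq> 0"
    using \<open>G \<noteq> 0\<close> by (simp add: coeff_rev_laguerre)
  then have "degree (rev_laguerre K G) > 0"
    using deg le_degree by fastforce
  then show ?case
    unfolding rev_laguerre_linear_mult using linear deg assms(1) by (intro stable_pderiv_diff) auto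
qed

text \<open>A second reversal undoes the one inside \<open>rev_laguerre\<close>. Taking K = N + 1
  meets the strict degree bound of \<open>stable_rev_laguerre\<close>.\<close>

lemma stability_multiplier_inverse_fact_rev:
  "stability_multiplier N (\<lambda>k. inverse (fact (Suc N - k)))"
  unfolding stability_multiplier_def
proof (intro allI impI)
  fix \<sigma> F
  assume F: "\<sigma> \<noteq> (0::real)" "halfplane_stable \<sigma> F" "degree F \<le> N"
  let ?H = "hadamard (\<lambda>k. inverse (fact (Suc N - k))) F :: complex poly"
  have "halfplane_stable (- \<sigma>) (coeff_rev (Suc N) ?H)"
    using F stable_rev_laguerre[of \<sigma> F "Suc N"] by (simp add: rev_laguerre_def)
  then have "halfplane_stable (- (- \<sigma>)) (coeff_rev (Suc N) (coeff_rev (Suc N) ?H))"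
    using degree_coeff_rev by (rule stable_coeff_rev)
  moreover have "degree ?H \<le> Suc N"
    using F(3) degree_hadamard_le[of _ F] by (meson le_SucI order_trans)
  ultimately show "halfplane_stable \<sigma> (hadamard (\<lambda>k. complex_of_real (inverse (fact (Suc N - k)))) F)"
    by (simp add: coeff_rev_coeff_rev)
qed

lemma stability_multiplier_inverse_fact:
  "stability_multiplier N (\<lambda>k. inverse (fact (Suc k)))"
  using stability_multiplier_rev[OF stability_multiplier_inverse_fact_rev[of N]]
  by (rule iffD1[OF stability_multiplier_cong, rotated]) (simp add: Suc_diff_le)

subsection \<open>Real-rooted polynomials\<close>

abbreviation cpoly :: "real poly \<Rightarrow> complex poly" where
  "cpoly \<equiv> map_poly complex_of_real"

lemma coeff_cpoly: "coeff (cpoly p) k = complex_of_real (coeff p k)"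
  by (simp add: coeff_map_poly)

lemma degree_cpoly: "degree (cpoly p) = degree p"
  by (rule degree_map_poly) simp

lemma cpoly_eq_0_iff: "cpoly p = 0 \<longleftrightarrow> p = 0"
  by (simp add: map_poly_eq_0_iff)

lemma cpoly_mult: "cpoly (p * q) = cpoly p * cpoly q"
  by (rule poly_eqI) (simp add: coeff_cpoly coeff_mult)

lemma cpoly_add: "cpoly (p + q) = cpoly p + cpoly q"
  by (rule poly_eqI) (simp add: coeff_cpoly)

lemma cpoly_pCons: "cpoly (pCons a p) = pCons (complex_of_real a) (cpoly p)"
  by (simp add: map_poly_pCons)

lemma poly_cpoly_of_real: "poly (cpoly p) (complex_of_real x) = complex_of_real (poly p x)"
  by (induction p) (simp_all add: cpoly_pCons)

lemma poly_cpoly_cnj: "poly (cpoly p) (cnj z) = cnj (poly (cpoly p) z)"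
  by (induction p) (simp_all add: cpoly_pCons)

lemma pderiv_cpoly: "pderiv (cpoly p) = cpoly (pderiv p)"
  by (rule poly_eqI) (simp add: coeff_pderiv coeff_cpoly)

lemma cpoly_hadamard: "cpoly (hadamard c p) = hadamard (\<lambda>k. complex_of_real (c k)) (cpoly p)"
  by (rule poly_eqI) (simp add: coeff_hadamard coeff_cpoly)

text \<open>Nonreal zeros of a real polynomial come in conjugate pairs, one of which would lie in
  the upper half-plane.\<close>

lemma stable_cpoly_imp_real_rooted:
  assumes "halfplane_stable 1 (cpoly p)"
  shows "real_rooted p"
proof -
  have "Im z = 0" if z: "poly (cpoly p) z = 0" for z
  proof -
    have "poly (cpoly p) (cnj z) = 0"
      using z by (simp add: poly_cpoly_cnj)
    then have "Im z \<le> 0" "Im (cnj z) \<le> 0"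
      using assms z unfolding halfplane_stable_def mult_1 by blast+
    then show ?thesis
      by simp
  qed
  then show ?thesis
    by (auto simp: real_rooted_def complex_zeros_def complex_is_Real_iff)
qed

lemma real_rooted_imp_nonzero: "real_rooted p \<Longrightarrow> p \<noteq> 0"
  using subsetD[of UNIV \<real> \<i>] by (auto simp: real_rooted_def complex_zeros_def complex_is_Real_iff)

lemma complex_zeros_mult: "complex_zeros (p * q) = complex_zeros p \<union> complex_zeros q"
  by (auto simp: complex_zeros_def cpoly_mult)

lemma real_rooted_mult: "real_rooted (p * q) \<longleftrightarrow> real_rooted p \<and> real_rooted q"
  by (auto simp: real_rooted_def complex_zeros_mult)

lemma real_rooted_root:
  assumes "real_rooted p" "degree p > 0"
  obtains r where "poly p r = 0"
proof -
  have "\<not> constant (poly (cpoly p))"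
    using assms(2) by (simp add: constant_degree degree_cpoly)
  then obtain z where z: "poly (cpoly p) z = 0"
    using fundamental_theorem_of_algebra by blast
  then have "z \<in> \<real>"
    using assms(1) by (auto simp: real_rooted_def complex_zeros_def)
  then obtain r where "z = complex_of_real r"
    by (rule Reals_cases)
  then show thesis
    using z that by (simp add: poly_cpoly_of_real)
qed

lemma size_proots_real_rooted:
  assumes "real_rooted p"
  shows "size (proots p) = degree p"
  using assms
proof (induction "degree p" arbitrary: p)
  case 0
  then show ?case
    by (metis degree_eq_zeroE proots_const size_empty zero_multiset_def)
next
  case (Suc n)
  then obtain r where "poly p r = 0"
    by (metis real_rooted_root zero_less_Suc)
  then obtain q where q: "p = [:- r, 1:] * q"
    by (auto simp: poly_eq_0_iff_dvd dvd_def)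
  have "real_rooted q"
    using Suc.prems unfolding q real_rooted_mult by simp
  then have "q \<noteq> 0"
    by (rule real_rooted_imp_nonzero)
  then have "degree p = Suc (degree q)"
    unfolding q by (subst degree_mult_eq) auto
  then show ?case
    using Suc \<open>real_rooted q\<close> \<open>q \<noteq> 0\<close> unfolding q by (subst proots_mult) auto
qed

subsection \<open>Root counts of Hermite--Biehler pairs\<close>

text \<open>The derivative of p/q is minus the Wronskian divided by q^2.\<close>

lemma wronskian_pos_quotient_decreasing:
  fixes p q :: "real poly"
  assumes W: "\<And>x. poly (pderiv q) x * poly p x - poly q x * poly (pderiv p) x > 0"
    and "a < b" and q: "\<And>x. a \<le> x \<Longrightarrow> x \<le> b \<Longrightarrow> poly q x \<noteq> 0"
  shows "poly p b / poly q b < poly p a / poly q a"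
proof (rule DERIV_neg_imp_decreasing[OF \<open>a < b\<close>])
  fix x
  assume x: "a \<le> x" "x \<le> b"
  have "((\<lambda>x. poly p x / poly q x) has_real_derivative
    (poly (pderiv p) x * poly q x - poly p x * poly (pderiv q) x) / (poly q x * poly q x)) (at x)"
    using q[OF x] by (intro derivative_intros) auto
  moreover have "(poly (pderiv p) x * poly q x - poly p x * poly (pderiv q) x) / (poly q x * poly q x) < 0"
    using W[of x] q[OF x] by (intro divide_neg_pos) (auto simp: algebra_simps zero_less_mult_iff)
  ultimately show "\<exists>y. ((\<lambda>x. poly p x / poly q x) has_real_derivative y) (at x) \<and> y < 0"
    by blast
qed

text \<open>
  As \<open>p / q\<close> decreases wherever \<open>q\<close> has no zero, \<open>q\<close> has a zero between any two zeros of \<open>p\<close>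
  and another one above the largest zero of \<open>p\<close>.
\<close>

lemma wronskian_pos_card_roots_le:
  fixes p q :: "real poly"
  assumes W: "\<And>x. poly (pderiv q) x * poly p x - poly q x * poly (pderiv p) x > 0"
    and lc: "lead_coeff p > 0" "lead_coeff q > 0"
  shows "card {u. poly p u = 0 \<and> x \<le> u} \<le> card {v. poly q v = 0 \<and> x \<le> v}"
proof -
  have "p \<noteq> 0" "q \<noteq> 0"
    using lc by auto
  have between: "\<exists>v. u < v \<and> v < u' \<and> poly q v = 0"
    if "poly p u = 0" "poly p u' = 0" "u < u'" for u u'
  proof (rule ccontr)
    assume "\<not> ?thesis"
    moreover have "poly q u \<noteq> 0" "poly q u' \<noteq> 0"
      using W[of u] W[of u'] that by auto
    ultimately have "poly q v \<noteq> 0" if "u \<le> v" "v \<le> u'" for v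
      using that by (metis order_le_less)
    then show False
      using wronskian_pos_quotient_decreasing[OF W \<open>u < u'\<close>] that by force
  qed
  have above: "\<exists>v. u < v \<and> poly q v = 0" if "poly p u = 0" for u
  proof (rule ccontr)
    assume *: "\<not> ?thesis"
    obtain m where m: "\<And>x. x \<ge> m \<Longrightarrow> poly p x \<ge> lead_coeff p"
      using poly_pinfty_gt_lc[OF lc(1)] by blast
    obtain n where n: "\<And>x. x \<ge> n \<Longrightarrow> poly q x \<ge> lead_coeff q"
      using poly_pinfty_gt_lc[OF lc(2)] by blast
    \<comment> \<open>Beyond \<open>b\<close> both polynomials are positive, whereas p/q would have
      decreased from its value 0 at u.\<close>
    define b where "b = max (u + 1) (max m n)"
    have "poly q u \<noteq> 0"
      using W[of u] that by auto
    then have "poly q v \<noteq> 0" if "u \<le> v" for v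
      using * that by (metis order_le_less)
    moreover have "u < b"
      by (simp add: b_def)
    ultimately have "poly p b / poly q b < 0"
      using wronskian_pos_quotient_decreasing[OF W \<open>u < b\<close>] that by force
    moreover have "poly p b > 0" "poly q b > 0"
      using m[of b] n[of b] lc by (auto simp: b_def intro: less_le_trans)
    ultimately show False
      by (simp add: divide_less_0_iff)
  qed
  \<comment> \<open>The next zero of q above u. A zero of q between two zeros of p makes \<phi>
    strictly monotone, hence injective.\<close>
  define \<phi> where "\<phi> u = Min {v. poly q v = 0 \<and> u < v}" for u
  have fin: "finite {v. poly q v = 0 \<and> P v}" for P
    using poly_roots_finite[OF \<open>q \<noteq> 0\<close>] by simp
  have \<phi>: "poly q (\<phi> u) = 0" "u < \<phi> u" if "poly p u = 0" for u
  proof -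
    have "\<phi> u \<in> {v. poly q v = 0 \<and> u < v}"
      unfolding \<phi>_def using above[OF that] fin by (intro Min_in) auto
    then show "poly q (\<phi> u) = 0" "u < \<phi> u"
      by auto
  qed
  have mono: "\<phi> u < \<phi> u'" if u: "poly p u = 0" "poly p u' = 0" "u < u'" for u u'
  proof -
    obtain v where "u < v" "v < u'" "poly q v = 0"
      using between[OF u] by blast
    then have "\<phi> u \<le> v"
      unfolding \<phi>_def using fin by (intro Min_le) auto
    then show ?thesis
      using \<open>v < u'\<close> \<phi>(2)[OF u(2)] by simp
  qed
  show ?thesis
  proof (rule card_inj_on_le)
    show "inj_on \<phi> {u. poly p u = 0 \<and> x \<le> u}"
      by (rule inj_onI) (metis (mono_tags) mem_Collect_eq mono linorder_neq_iff)
    show "\<phi> ` {u. poly p u = 0 \<and> x \<le> u} \<subseteq> {v. poly q v = 0 \<and> x \<le> v}"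
      using \<phi> by (force intro: less_imp_le)
  qed (rule fin)
qed

text \<open>All zeros of F = q + i p lie strictly below the real line, so F'/F has negative
  imaginary part at real x. That imaginary part is minus the Wronskian divided by p^2 + q^2.\<close>

lemma hermite_biehler_wronskian:
  assumes st: "halfplane_stable 1 (cpoly q + smult \<i> (cpoly p))"
    and "degree p > 0" and coprime: "\<And>x. poly p x \<noteq> 0 \<or> poly q x \<noteq> 0"
  shows "poly (pderiv q) x * poly p x - poly q x * poly (pderiv p) x > 0"
proof -
  define F where "F = cpoly q + smult \<i> (cpoly p)"
  have "Im r < 0" if "poly F r = 0" for r
  proof -
    have "Im r \<le> 0"
      using st that by (simp add: halfplane_stable_def F_def)
    \<comment> \<open>A real zero of q + i p would be a common zero of p and q.\<close>
    moreover have "Im r \<noteq> 0"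
    proof
      assume "Im r = 0"
      then obtain y where y: "r = complex_of_real y"
        using complex_is_Real_iff Reals_cases by metis
      then have "Complex (poly q y) (poly p y) = 0"
        using that by (simp add: F_def poly_cpoly_of_real Complex_eq mult.commute)
      then show False
        using coprime[of y] by (simp add: complex_eq_iff)
    qed
    ultimately show ?thesis
      by simp
  qed
  then have "{r. poly F r = 0} \<subseteq> {r. 1 * Im r < 1 * Im (complex_of_real x)}"
    by auto
  \<comment> \<open>The imaginary part of this coefficient is the leading coefficient of p, so F is
    not constant.\<close>
  moreover have "coeff F (degree p) \<noteq> 0"
    using \<open>degree p > 0\<close> by (auto simp: F_def coeff_cpoly complex_eq_iff)
  then have "degree F > 0"
    using \<open>degree p > 0\<close> le_degree by fastforce
  ultimately have "Im (poly (pderiv F) (complex_of_real x) / poly F (complex_of_real x)) < 0"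
    using log_deriv_beyond_roots[of F 1 "complex_of_real x"] by fastforce
  moreover have "poly F (complex_of_real x) = Complex (poly q x) (poly p x)"
    "poly (pderiv F) (complex_of_real x) = Complex (poly (pderiv q) x) (poly (pderiv p) x)"
    by (simp_all add: F_def pderiv_add pderiv_smult pderiv_cpoly poly_cpoly_of_real complex_eq_iff)
  ultimately have "(poly (pderiv p) x * poly q x - poly (pderiv q) x * poly p x) /
      ((poly q x)\<^sup>2 + (poly p x)\<^sup>2) < 0"
    by (simp add: Im_divide)
  moreover have "(poly q x)\<^sup>2 + (poly p x)\<^sup>2 > 0"
    using coprime[of x] by (auto simp: sum_power2_gt_zero_iff)
  ultimately show ?thesis
    by (simp add: divide_less_0_iff algebra_simps)
qed

text \<open>Common real zeros add equally to both counts and are divided out. Then the Wronskian is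
  positive, which makes the zeros of p simple, and counting zeros of q with multiplicity can only
  enlarge the right-hand side.\<close>

lemma hermite_biehler_count:
  assumes "halfplane_stable 1 (cpoly q + smult \<i> (cpoly p))"
    and "lead_coeff p > 0" "lead_coeff q > 0"
  shows "size {#u \<in># proots p. x \<le> u#} \<le> size {#v \<in># proots q. x \<le> v#}"
  using assms
proof (induction "degree p" arbitrary: p q rule: less_induct)
  case less
  have nz: "p \<noteq> 0" "q \<noteq> 0"
    using less.prems by auto
  consider "degree p = 0" | r where "poly p r = 0" "poly q r = 0"
    | "degree p > 0" "\<And>r. poly p r \<noteq> 0 \<or> poly q r \<noteq> 0"
    by blast
  then show ?case
  proof cases
    case 1
    then obtain a where "p = [:a:]"
      by (metis degree_eq_zeroE)
    then have "proots p = {#}"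
      by simp
    then show ?thesis
      by (simp only:) simp
  next
    case 2
    then obtain p' q' where pq: "p = [:- r, 1:] * p'" "q = [:- r, 1:] * q'"
      by (auto simp: poly_eq_0_iff_dvd dvd_def)
    have nz': "p' \<noteq> 0" "q' \<noteq> 0"
      using nz pq by auto
    then have "degree p = Suc (degree p')"
      unfolding pq by (subst degree_mult_eq) auto
    moreover have "cpoly q + smult \<i> (cpoly p) =
        cpoly [:- r, 1:] * (cpoly q' + smult \<i> (cpoly p'))"
      unfolding pq cpoly_mult by (simp only: distrib_left mult_smult_right)
    then have "halfplane_stable 1 (cpoly q' + smult \<i> (cpoly p'))"
      using less.prems(1) by (simp only: stable_mult)
    moreover have "lead_coeff p' > 0" "lead_coeff q' > 0"
      using less.prems(2,3) unfolding pq lead_coeff_mult by auto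
    ultimately have "size {#u \<in># proots p'. x \<le> u#} \<le> size {#v \<in># proots q'. x \<le> v#}"
      by (intro less.hyps) auto
    then show ?thesis
      using nz' unfolding pq by (subst (1 2) proots_mult) auto
  next
    case 3
    have W: "poly (pderiv q) x * poly p x - poly q x * poly (pderiv p) x > 0" for x
      using hermite_biehler_wronskian[OF less.prems(1) 3] .
    have simple: "order u p = 1" if "poly p u = 0" for u
    proof -
      have "poly (pderiv p) u \<noteq> 0"
        using W[of u] that by auto
      then have "order u (pderiv p) = 0"
        by (rule order_0I)
      then show ?thesis
        using order_pderiv[OF nz(1) that] by simp
    qed
    have "size {#u \<in># proots p. x \<le> u#} = (\<Sum>u | poly p u = 0 \<and> x \<le> u. 1)"
      unfolding size_multiset_overloaded_eq using nz simple by (intro sum.cong) auto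
    also have "\<dots> \<le> card {v. poly q v = 0 \<and> x \<le> v}"
      using wronskian_pos_card_roots_le[OF W less.prems(2,3)] by simp
    also have "\<dots> = (\<Sum>v | poly q v = 0 \<and> x \<le> v. 1)"
      by simp
    also have "\<dots> \<le> size {#v \<in># proots q. x \<le> v#}"
    proof -
      have "(\<Sum>v | poly q v = 0 \<and> x \<le> v. 1) \<le> (\<Sum>v | poly q v = 0 \<and> x \<le> v. order v q)"
        using nz order_root[of q] by (intro sum_mono) (auto simp: Suc_le_eq)
      also have "\<dots> = size {#v \<in># proots q. x \<le> v#}"
        unfolding size_multiset_overloaded_eq using nz by (intro sum.cong) auto
      finally show ?thesis .
    qed
    finally show ?thesis .
  qed
qed

text \<open>Take the threshold x = \<open>us ! i\<close>: at least i + 1 entries of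
  \<open>us\<close> reach it, but if \<open>vs ! i\<close> were smaller, at most the first i entries
  of \<open>vs\<close> would.\<close>

lemma nth_le_nth_if_count_le:
  fixes us vs :: "'a::linorder list"
  assumes "sorted_wrt (\<ge>) us" "sorted_wrt (\<ge>) vs" "i < length us"
    and le: "\<And>x. length (filter ((\<le>) x) us) \<le> length (filter ((\<le>) x) vs)"
  shows "us ! i \<le> vs ! i"
proof (rule ccontr)
  assume *: "\<not> us ! i \<le> vs ! i"
  have "x \<ge> us ! i" if x: "x \<in> set (take (Suc i) us)" for x
  proof -
    obtain j where "j \<le> i" "x = us ! j"
      using x assms(3) by (auto simp: in_set_conv_nth less_Suc_eq_le)
    then show ?thesis
      using assms(1,3) by (cases "j = i") (auto simp: sorted_wrt_iff_nth_less)
  qed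
  then have "filter ((\<le>) (us ! i)) (take (Suc i) us) = take (Suc i) us"
    by (auto simp: filter_id_conv)
  then have "Suc i = length (filter ((\<le>) (us ! i)) (take (Suc i) us))"
    using assms(3) by simp
  also have "\<dots> \<le> length (filter ((\<le>) (us ! i)) us)"
    by (metis append_take_drop_id filter_append le_add1 length_append)
  also have "\<dots> \<le> length (filter ((\<le>) (us ! i)) vs)"
    by (rule le)
  also have "\<dots> = length (filter ((\<le>) (us ! i)) (take i vs)) + length (filter ((\<le>) (us ! i)) (drop i vs))"
    by (metis append_take_drop_id filter_append length_append)
  also have "filter ((\<le>) (us ! i)) (drop i vs) = []"
  proof -
    have "x \<le> vs ! i" if x: "x \<in> set (drop i vs)" for x
    proof -
      obtain j where "j < length vs - i" "x = vs ! (i + j)"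
        using x by (auto simp: in_set_conv_nth)
      then show ?thesis
        using assms(2) by (cases "j = 0") (auto simp: sorted_wrt_iff_nth_less)
    qed
    then show ?thesis
      using * by (force simp: filter_empty_conv)
  qed
  also have "length (filter ((\<le>) (us ! i)) (take i vs)) + length [] \<le> i"
    by (metis add.right_neutral length_filter_le length_take list.size(3) min.bounded_iff order_refl order_trans min.cobounded2)
  finally show False
    by simp
qed

subsection \<open>Sorted lists of roots\<close>

lemma mset_roots_desc: "mset (roots_desc p) = proots p"
  by (simp add: roots_desc_def)

lemma sorted_roots_desc: "sorted_wrt (\<ge>) (roots_desc p)"
  by (simp add: roots_desc_def sorted_wrt_rev)

lemma set_roots_desc: "p \<noteq> 0 \<Longrightarrow> set (roots_desc p) = {x. poly p x = 0}"
  by (metis mset_roots_desc set_count_proots set_mset_mset)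

lemma length_roots_desc: "real_rooted p \<Longrightarrow> length (roots_desc p) = degree p"
  by (metis mset_roots_desc size_mset size_proots_real_rooted)

lemma roots_desc_nth_le:
  assumes "\<And>x. size {#u \<in># proots p. x \<le> u#} \<le> size {#v \<in># proots q. x \<le> v#}"
    and "real_rooted p" "i < degree p"
  shows "roots_desc p ! i \<le> roots_desc q ! i"
proof (rule nth_le_nth_if_count_le[OF sorted_roots_desc sorted_roots_desc])
  show "i < length (roots_desc p)"
    using assms by (simp add: length_roots_desc)
  show "length (filter ((\<le>) x) (roots_desc p)) \<le> length (filter ((\<le>) x) (roots_desc q))" for x
    using assms(1)[of x] by (simp flip: mset_roots_desc add: mset_filter[symmetric] del: mset_filter)
qed

text \<open>Reflection fixes p and turns a power of t - r into a scalar multiple of the same power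
  of t - 1/r. Using this for r and for 1/r gives both inequalities.\<close>

lemma order_inverse_palindromic:
  fixes p :: "real poly"
  assumes "reflect_poly p = p" "p \<noteq> 0"
  shows "order (inverse r) p = order r p"
proof -
  have le: "order r p \<le> order (inverse r) p" if "r \<noteq> 0" for r
  proof -
    have "reflect_poly [:- r, 1:] = smult (- r) [:- inverse r, 1:]"
      using that by (simp add: reflect_poly_pCons)
    moreover obtain q where "p = [:- r, 1:] ^ order r p * q"
      using order_1 by (rule dvdE)
    then have "reflect_poly ([:- r, 1:] ^ order r p) dvd reflect_poly p"
      by (metis dvd_triv_left reflect_poly_mult)
    ultimately have "smult (- r) [:- inverse r, 1:] ^ order r p dvd p"
      by (simp only: reflect_poly_power assms(1))
    then have "[:- inverse r, 1:] ^ order r p dvd p"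
      unfolding smult_power by (rule smult_dvd_cancel)
    then show ?thesis
      using assms(2) by (simp add: order_divides)
  qed
  show ?thesis
  \<comment> \<open>For r = 0 the claim is trivial, as \<open>inverse 0 = 0\<close>.\<close>
  proof (cases "r = 0")
    case False
    then show ?thesis
      using le[of r] le[of "inverse r"] by simp
  qed auto
qed

text \<open>Inversion permutes the multiset of zeros and reverses the order of negative numbers, so
  it maps the descending list of zeros to the ascending one.\<close>

lemma roots_desc_palindromic:
  assumes p: "reflect_poly p = p" "real_rooted p" and neg: "\<And>x. poly p x = 0 \<Longrightarrow> x < 0"
    and i: "i < degree p"
  shows "roots_desc p ! (degree p - Suc i) = inverse (roots_desc p ! i)"
proof -
  let ?us = "roots_desc p"
  have "p \<noteq> 0"
    using p(2) by (rule real_rooted_imp_nonzero)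
  have "image_mset inverse (proots p) = proots p"
  proof (rule multiset_eqI)
    fix r :: real
    have "inverse -` {r} = {inverse r}"
      by (auto simp: field_simps)
    then have "count (image_mset inverse (proots p)) r = count (proots p) (inverse r)"
      by (cases "inverse r \<in># proots p") (simp_all add: count_image_mset not_in_iff)
    then show "count (image_mset inverse (proots p)) r = count (proots p) r"
      using \<open>p \<noteq> 0\<close> p(1) by (simp add: order_inverse_palindromic)
  qed
  then have "mset (map inverse ?us) = proots p"
    by (simp add: mset_roots_desc)
  moreover have "sorted (map inverse ?us)"
    unfolding sorted_map
  proof (rule sorted_wrt_mono_rel[OF _ sorted_roots_desc])
    fix x y
    assume "x \<in> set ?us" "y \<in> set ?us" "x \<ge> y"
    then show "inverse x \<le> inverse y"
      using neg \<open>p \<noteq> 0\<close> by (simp add: set_roots_desc le_imp_inverse_le_neg)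
  qed
  ultimately have "map inverse ?us = rev ?us"
    unfolding roots_desc_def by (metis rev_rev_ident sorted_list_of_multiset_mset sorted_sort_id)
  moreover have "length ?us = degree p"
    using p(2) by (rule length_roots_desc)
  ultimately show ?thesis
    using i by (metis nth_map rev_nth)
qed

subsection \<open>Super-Eulerian polynomials\<close>

lemma super_eulerian_eq_0: "n \<le> k \<Longrightarrow> super_eulerian l n k = 0"
  by (cases "(l, n, k)" rule: super_eulerian.cases) auto

text \<open>For k > n both summands vanish by \<open>super_eulerian_eq_0\<close>, so a single
  equation holds for all k.\<close>

lemma super_eulerian_Suc:
  assumes "n \<ge> 1"
  shows "super_eulerian l (Suc n) k = Suc k ^ l * super_eulerian l n k +
    (Suc n - k) ^ l * (if k = 0 then 0 else super_eulerian l n (k - 1))"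
  using assms by (cases n) (auto simp: super_eulerian_eq_0)

lemma super_eulerian_pos: "k < n \<Longrightarrow> super_eulerian l n k > 0"
proof (induction n arbitrary: k)
  case (Suc n)
  then show ?case
    by (cases "n = 0"; cases "k = n") (auto simp: super_eulerian_Suc simp del: super_eulerian.simps(3))
qed simp

lemma super_eulerian_0: "n \<ge> 1 \<Longrightarrow> super_eulerian l n 0 = 1"
  by (induction n rule: dec_induct) (simp_all add: super_eulerian_Suc del: super_eulerian.simps(3))

text \<open>Replacing k by n - k exchanges the two summands of the recursion for row n + 1. At k = 0
  and k = n only one summand survives.\<close>

lemma super_eulerian_symmetric:
  "k < n \<Longrightarrow> super_eulerian l n (n - Suc k) = super_eulerian l n k"
proof (induction n arbitrary: k)
  case (Suc n)
  show ?case
  proof (cases "n = 0")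
    case False
    have "super_eulerian l (Suc n) (n - k) = super_eulerian l (Suc n) k"
    proof (cases k)
      case 0
      then show ?thesis
        using False Suc.IH[of 0] by (simp add: super_eulerian_Suc super_eulerian_eq_0 del: super_eulerian.simps(3))
    next
      case (Suc j)
      show ?thesis
      proof (cases "k = n")
        case True
        then show ?thesis
          using False Suc.IH[of 0] \<open>k = Suc j\<close>
          by (simp add: super_eulerian_Suc super_eulerian_eq_0 del: super_eulerian.simps(3))
      next
        case neq: False
        then have "k < n"
          using Suc.prems by simp
        then have "super_eulerian l n (n - k) = super_eulerian l n (k - 1)"
          "super_eulerian l n (n - k - 1) = super_eulerian l n k"
          using Suc.IH[of "k - 1"] Suc.IH[of k] \<open>k = Suc j\<close> by simp_all
        then show ?thesis
          using False \<open>k < n\<close> \<open>k = Suc j\<close>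
          by (simp add: super_eulerian_Suc Suc_diff_Suc Suc_diff_le add.commute del: super_eulerian.simps(3))
      qed
    qed
    then show ?thesis
      by simp
  qed (use Suc.prems in auto)
qed simp

lemma coeff_super_eulerian_poly:
  "coeff (super_eulerian_poly l n) k = real (super_eulerian l n k)"
  by (simp add: super_eulerian_poly_def coeff_sum super_eulerian_eq_0)

lemma degree_super_eulerian_poly:
  assumes "n \<ge> 1"
  shows "degree (super_eulerian_poly l n) = n - 1"
proof (rule antisym)
  show "degree (super_eulerian_poly l n) \<le> n - 1"
    by (rule degree_le) (auto simp: coeff_super_eulerian_poly super_eulerian_eq_0)
  show "n - 1 \<le> degree (super_eulerian_poly l n)"
    using assms super_eulerian_pos[of "n - 1" n l]
    by (intro le_degree) (simp add: coeff_super_eulerian_poly)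
qed

lemma lead_coeff_super_eulerian_poly: "n \<ge> 1 \<Longrightarrow> lead_coeff (super_eulerian_poly l n) > 0"
  using super_eulerian_pos[of "n - 1" n l]
  by (simp add: degree_super_eulerian_poly coeff_super_eulerian_poly)

lemma reflect_super_eulerian_poly:
  assumes "n \<ge> 1"
  shows "reflect_poly (super_eulerian_poly l n) = super_eulerian_poly l n"
proof (rule poly_eqI)
  fix k
  show "coeff (reflect_poly (super_eulerian_poly l n)) k = coeff (super_eulerian_poly l n) k"
    using assms super_eulerian_symmetric[of k n l]
    by (auto simp: coeff_reflect_poly degree_super_eulerian_poly coeff_super_eulerian_poly super_eulerian_eq_0)
qed

text \<open>
  The weights are chosen such that both summands of the recursion acquire the same factor,
  namely \<open>((k + 1) (n + 1 - k))^l\<close>.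
\<close>

definition weighted_super_eulerian_poly :: "nat \<Rightarrow> nat \<Rightarrow> real poly" where
  "weighted_super_eulerian_poly l n =
    hadamard (\<lambda>k. (fact (Suc k) * fact (n - k)) ^ l) (super_eulerian_poly l n)"

lemma weighted_super_eulerian_poly_Suc:
  assumes "n \<ge> 1"
  shows "weighted_super_eulerian_poly l (Suc n) =
    hadamard (\<lambda>k. (real (Suc k) * real (Suc n - k)) ^ l) ([:1, 1:] * weighted_super_eulerian_poly l n)"
proof (rule poly_eqI)
  fix k
  let ?w = "\<lambda>n k. (fact (Suc k) * fact (n - k)) ^ l :: real"
  let ?c = "(real (Suc k) * real (Suc n - k)) ^ l"
  \<comment> \<open>Up to the power l, the new weight is n + 1 - k times the old one at k, and the
    recursion supplies k + 1.\<close>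
  have 1: "?w (Suc n) k * (real (Suc k) ^ l * real (super_eulerian l n k)) =
    ?c * (?w n k * real (super_eulerian l n k))"
  proof (cases "k < n")
    case True
    then show ?thesis
      by (simp add: Suc_diff_le power_mult_distrib)
  qed (simp add: super_eulerian_eq_0)
  \<comment> \<open>Here the roles are exchanged: the new weight is k + 1 times the old one at k -
    1, and the recursion supplies n + 1 - k.\<close>
  have 2: "?w (Suc n) k * (real (Suc n - k) ^ l * real (super_eulerian l n (k - 1))) =
    ?c * (?w n (k - 1) * real (super_eulerian l n (k - 1)))" if "k \<noteq> 0"
  proof -
    obtain j where "k = Suc j"
      using \<open>k \<noteq> 0\<close> by (cases k) auto
    then show ?thesis
      by (simp add: power_mult_distrib)
  qed
  show "coeff (weighted_super_eulerian_poly l (Suc n)) k = coeff (hadamard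
      (\<lambda>k. (real (Suc k) * real (Suc n - k)) ^ l) ([:1, 1:] * weighted_super_eulerian_poly l n)) k"
    unfolding weighted_super_eulerian_poly_def coeff_hadamard coeff_super_eulerian_poly
      super_eulerian_Suc[OF assms] of_nat_add of_nat_mult of_nat_power distrib_left 1
    using 2 by (cases k) (simp_all add: coeff_hadamard coeff_super_eulerian_poly distrib_left
        del: of_nat_Suc fact_Suc)
qed

lemma degree_weighted_super_eulerian_poly:
  "n \<ge> 1 \<Longrightarrow> degree (weighted_super_eulerian_poly l n) \<le> n - 1"
  unfolding weighted_super_eulerian_poly_def
  by (metis degree_hadamard_le degree_super_eulerian_poly)

section \<open>Stability of the super-Eulerian polynomials\<close>

lemma stability_multiplier_step:
  "stability_multiplier n (\<lambda>k. (real (Suc k) * real (Suc n - k)) ^ l)"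
  by (intro stability_multiplier_power stability_multiplier_mult
      stability_multiplier_Suc stability_multiplier_rev_Suc)

lemma stability_multiplier_unweight:
  "stability_multiplier n (\<lambda>k. (inverse (fact (Suc k)) * inverse (fact (Suc n - k))) ^ l)"
  by (intro stability_multiplier_power stability_multiplier_mult
      stability_multiplier_inverse_fact stability_multiplier_inverse_fact_rev)

lemma stable_weighted_super_eulerian_poly:
  "n \<ge> 1 \<Longrightarrow> halfplane_stable 1 (cpoly (weighted_super_eulerian_poly l n))"
proof (induction n rule: dec_induct)
  case base
  have "super_eulerian_poly l 1 = [:1:]"
    by (simp add: super_eulerian_poly_def monom_0)
  moreover have "hadamard c [:1:] = [:c 0:]" for c :: "nat \<Rightarrow> real"
    by (simp add: hadamard_def monom_0)
  ultimately show ?case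
    by (simp add: weighted_super_eulerian_poly_def cpoly_pCons)
next
  case (step n)
  have "halfplane_stable 1 ([:1, 1:] * cpoly (weighted_super_eulerian_poly l n))"
    using step by (simp only: stable_mult) simp
  moreover have "degree ([:1, 1:] * cpoly (weighted_super_eulerian_poly l n)) \<le> n"
    using degree_weighted_super_eulerian_poly[OF step.hyps(1), of l] step.hyps(1)
    by (intro order_trans[OF degree_mult_le]) (simp add: degree_cpoly)
  ultimately have "halfplane_stable 1 (hadamard (\<lambda>k. complex_of_real ((real (Suc k) * real (Suc n - k)) ^ l))
      ([:1, 1:] * cpoly (weighted_super_eulerian_poly l n)))"
    using stability_multiplierD[OF stability_multiplier_step] by simp
  moreover have "cpoly [:1, 1:] = [:1, 1:]"
    by (simp add: cpoly_pCons)
  ultimately show ?case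
    unfolding weighted_super_eulerian_poly_Suc[OF step.hyps(1)] cpoly_hadamard cpoly_mult
    by (simp only:)
qed

lemma super_eulerian_poly_unweight:
  "super_eulerian_poly l (Suc n) =
    hadamard (\<lambda>k. (inverse (fact (Suc k)) * inverse (fact (Suc n - k))) ^ l)
      (weighted_super_eulerian_poly l (Suc n))"
proof (rule poly_eqI)
  fix k
  have "(inverse a * inverse b) ^ l * (a * b) ^ l = 1" if "a \<noteq> 0" "b \<noteq> 0" for a b :: real
    using that by (simp add: field_simps flip: power_mult_distrib)
  from this[of "fact (Suc k)" "fact (Suc n - k)"]
  show "coeff (super_eulerian_poly l (Suc n)) k =
    coeff (hadamard (\<lambda>k. (inverse (fact (Suc k)) * inverse (fact (Suc n - k))) ^ l)
      (weighted_super_eulerian_poly l (Suc n))) k"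
    by (simp only: weighted_super_eulerian_poly_def coeff_hadamard mult.assoc[symmetric] fact_nonzero
        not_False_eq_True simp_thms mult_1)
qed

lemma stable_super_eulerian_poly:
  assumes "n \<ge> 1"
  shows "halfplane_stable 1 (cpoly (super_eulerian_poly l n))"
proof -
  obtain m where m: "n = Suc m"
    using assms by (cases n) auto
  show ?thesis
    unfolding m super_eulerian_poly_unweight cpoly_hadamard
    using stable_weighted_super_eulerian_poly[of "Suc m" l]
      degree_weighted_super_eulerian_poly[of "Suc m" l]
    by (intro stability_multiplierD[OF stability_multiplier_unweight]) (auto simp: degree_cpoly)
qed

lemma hadamard_add_smult: "hadamard c (p + smult a q) = hadamard c p + smult a (hadamard c q)"
  by (rule poly_eqI) (simp add: coeff_hadamard algebra_simps)

lemma stable_super_eulerian_poly_Suc: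
  assumes "n \<ge> 1"
  shows "halfplane_stable 1 (cpoly (super_eulerian_poly l (Suc n)) +
    smult \<i> (cpoly (hadamard (\<lambda>k. real (Suc k) ^ l) (super_eulerian_poly l n))))"
proof -
  let ?c = "\<lambda>k. (real (Suc k) * real (Suc n - k)) ^ l"
  let ?d = "\<lambda>k. (inverse (fact (Suc k)) * inverse (fact (Suc n - k))) ^ l :: real"
  let ?W = "weighted_super_eulerian_poly l n"
  \<comment> \<open>The linear factor vanishes at -1 - i, in the lower half-plane. Its summand i
    sends \<open>?W\<close> through the same multipliers as (1 + t) \<open>?W\<close>.\<close>
  let ?F = "[:1 + \<i>, 1:] * cpoly ?W"
  have deg: "degree ?F \<le> n"
    using degree_weighted_super_eulerian_poly[OF assms, of l] assms
    by (intro order_trans[OF degree_mult_le]) (simp add: degree_cpoly)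
  have F: "?F = cpoly ([:1, 1:] * ?W) + smult \<i> (cpoly ?W)"
    by (simp add: cpoly_add cpoly_pCons smult_add_left)
  have "halfplane_stable 1 ?F"
    using stable_weighted_super_eulerian_poly[OF assms] by (simp only: stable_mult) simp
  then have "halfplane_stable 1 (hadamard (\<lambda>k. complex_of_real (?d k))
      (hadamard (\<lambda>k. complex_of_real (?c k)) ?F))"
    using deg order_trans[OF degree_hadamard_le deg]
    by (intro stability_multiplierD[OF stability_multiplier_unweight]
        stability_multiplierD[OF stability_multiplier_step]) auto
  also have "hadamard (\<lambda>k. complex_of_real (?d k)) (hadamard (\<lambda>k. complex_of_real (?c k)) ?F) =
      cpoly (hadamard ?d (hadamard ?c ([:1, 1:] * ?W))) +
      smult \<i> (cpoly (hadamard ?d (hadamard ?c ?W)))"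
    unfolding F hadamard_add_smult cpoly_hadamard ..
  also have "hadamard ?d (hadamard ?c ([:1, 1:] * ?W)) = super_eulerian_poly l (Suc n)"
    unfolding super_eulerian_poly_unweight weighted_super_eulerian_poly_Suc[OF assms] ..
  \<comment> \<open>For k < n the inverse weight of row n + 1, the factor \<open>?c\<close> and the
    weight of row n multiply to (k + 1)^l.\<close>
  also have "hadamard ?d (hadamard ?c ?W) = hadamard (\<lambda>k. real (Suc k) ^ l) (super_eulerian_poly l n)"
  proof (rule poly_eqI)
    fix k
    show "coeff (hadamard ?d (hadamard ?c ?W)) k =
      coeff (hadamard (\<lambda>k. real (Suc k) ^ l) (super_eulerian_poly l n)) k"
    proof (cases "k < n")
      case True
      have fact: "fact (Suc n - k) = real (Suc n - k) * fact (n - k)"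
        using True by (simp add: Suc_diff_le)
      have "(inverse a * inverse (m * b)) * (c * m) * (a * b) = c"
        if "a \<noteq> 0" "b \<noteq> 0" "m \<noteq> 0" for a b c m :: real
        using that by (simp add: field_simps)
      from this[of "fact (Suc k)" "fact (n - k)" "real (Suc n - k)" "real (Suc k)"]
      have "?d k * ?c k * (fact (Suc k) * fact (n - k)) ^ l = real (Suc k) ^ l"
        using True unfolding power_mult_distrib[symmetric] fact
        by (intro arg_cong[of _ _ "\<lambda>x. x ^ l"]) (simp only: fact_nonzero of_nat_eq_0_iff, simp)
      then show ?thesis
        by (simp only: coeff_hadamard weighted_super_eulerian_poly_def mult.assoc[symmetric])
    qed (simp add: coeff_hadamard weighted_super_eulerian_poly_def coeff_super_eulerian_poly super_eulerian_eq_0)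
  qed
  finally show ?thesis .
qed

section \<open>Zeros under the operator f -> (t f)'\<close>

lemma complex_zeros_nonneg_coeffs:
  assumes "halfplane_stable 1 (cpoly p)" and nonneg: "\<And>k. coeff p k \<ge> 0"
  shows "complex_zeros p \<subseteq> complex_of_real ` {..0}"
proof
  fix z
  assume z: "z \<in> complex_zeros p"
  have "real_rooted p"
    using assms(1) by (rule stable_cpoly_imp_real_rooted)
  then have "p \<noteq> 0" "z \<in> \<real>"
    using z real_rooted_imp_nonzero unfolding real_rooted_def by blast+
  then obtain x where x: "z = complex_of_real x"
    using Reals_cases by blast
  then have "poly p x = 0"
    using z by (simp add: complex_zeros_def poly_cpoly_of_real)
  moreover have "lead_coeff p > 0"
    using nonneg[of "degree p"] \<open>p \<noteq> 0\<close> by (simp add: less_le)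
  then have "poly p x > 0" if "x > 0"
    unfolding poly_altdef using that nonneg by (intro sum_pos2[of _ "degree p"]) simp_all
  ultimately have "x \<le> 0"
    by force
  then show "z \<in> complex_of_real ` {..0}"
    using x by auto
qed

text \<open>z F'/F is the sum of z/(z - r) over the roots, and for real r \<le> 0 the imaginary part
  of a summand is - r Im z / |z - r|^2.\<close>

lemma Im_mult_log_deriv_nonneg:
  assumes "F \<noteq> 0" "{z. poly F z = 0} \<subseteq> complex_of_real ` {..0}" "Im z > 0"
  shows "Im (z * (poly (pderiv F) z / poly F z)) \<ge> 0"
  using assms(1,2)
proof (induction rule: complex_poly_roots_induct)
  case (linear r G)
  have "poly G z \<noteq> 0" "z \<noteq> r"
    using linear(1,3) assms(3) by auto
  obtain x where x: "r = complex_of_real x" "x \<le> 0"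
    using linear by auto
  have "Im (z * inverse (z - r)) = - x * Im z / ((Re z - x)\<^sup>2 + (Im z)\<^sup>2)"
    by (simp add: x flip: divide_inverse) (simp add: Im_divide x algebra_simps)
  also have "\<dots> \<ge> 0"
    using \<open>x \<le> 0\<close> assms(3) by (intro divide_nonneg_nonneg mult_nonneg_nonneg) simp_all
  finally show ?case
    using linear.IH
    unfolding log_deriv_linear_mult[OF \<open>z \<noteq> r\<close> \<open>poly G z \<noteq> 0\<close>] distrib_left plus_complex.sel
    by linarith
qed (simp add: pderiv_pCons)

text \<open>The polynomial factors as p times 1 + i + z p'/p, and in the upper half-plane the second
  factor has imaginary part at least 1.\<close>

lemma stable_hadamard_Suc_add:
  assumes "p \<noteq> 0" "complex_zeros p \<subseteq> complex_of_real ` {..0}"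
  shows "halfplane_stable 1 (cpoly (hadamard (\<lambda>k. real (Suc k)) p) + smult \<i> (cpoly p))"
proof (rule halfplane_stableI)
  fix z
  assume "1 * Im z > 0"
  then have z: "Im z > 0"
    by simp
  let ?F = "cpoly p"
  have "hadamard (\<lambda>k. real (Suc k)) p = p + [:0, 1:] * pderiv p"
    by (rule poly_eqI) (simp add: coeff_hadamard coeff_pCons coeff_pderiv algebra_simps split: nat.split)
  then have eq: "cpoly (hadamard (\<lambda>k. real (Suc k)) p) = ?F + [:0, 1:] * pderiv ?F"
    by (simp add: cpoly_add cpoly_pCons pderiv_cpoly)
  have nz: "poly ?F z \<noteq> 0"
    using assms(2) z by (auto simp: complex_zeros_def)
  have "poly (cpoly (hadamard (\<lambda>k. real (Suc k)) p) + smult \<i> ?F) z =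
      poly ?F z * (1 + \<i> + z * (poly (pderiv ?F) z / poly ?F z))"
    unfolding eq using nz by (simp add: field_simps)
  moreover have "Im (1 + \<i> + z * (poly (pderiv ?F) z / poly ?F z)) > 0"
    using Im_mult_log_deriv_nonneg[of ?F z] assms z
    by (simp only: plus_complex.sel) (simp add: complex_zeros_def cpoly_eq_0_iff)
  then have "1 + \<i> + z * (poly (pderiv ?F) z / poly ?F z) \<noteq> 0"
    by (metis less_irrefl zero_complex.simps(2))
  ultimately show "poly (cpoly (hadamard (\<lambda>k. real (Suc k)) p) + smult \<i> ?F) z \<noteq> 0"
    using nz by (simp only: mult_eq_0_iff simp_thms)
qed simp

lemma lead_coeff_hadamard_pos:
  fixes p :: "real poly"
  assumes "\<And>k. c k > 0" "lead_coeff p > 0"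
  shows "lead_coeff (hadamard c p) > 0"
proof -
  have "coeff (hadamard c p) (degree p) > 0"
    using assms by (simp add: coeff_hadamard)
  moreover from this have "degree (hadamard c p) = degree p"
    by (intro antisym degree_hadamard_le le_degree) auto
  ultimately show ?thesis
    by simp
qed

text \<open>One application of f -> (t f)' does not lower the counts, and it preserves stability and
  nonnegative coefficients, so it can be iterated.\<close>

lemma count_roots_hadamard_Suc_power:
  assumes "halfplane_stable 1 (cpoly p)" "\<And>k. coeff p k \<ge> 0"
  shows "size {#u \<in># proots p. x \<le> u#} \<le>
    size {#v \<in># proots (hadamard (\<lambda>k. real (Suc k) ^ l) p). x \<le> v#}"
proof (induction l)
  case 0
  have "hadamard (\<lambda>k. 1) p = p"
    by (rule poly_eqI) (simp add: coeff_hadamard)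
  then show ?case
    by simp
next
  case (Suc l)
  let ?p = "hadamard (\<lambda>k. real (Suc k) ^ l) p"
  have "p \<noteq> 0"
    using assms(1) by (auto simp: halfplane_stable_def cpoly_eq_0_iff)
  have st: "halfplane_stable 1 (cpoly ?p)"
    unfolding cpoly_hadamard using assms(1)
    by (intro stability_multiplierD[OF stability_multiplier_power[OF stability_multiplier_Suc]]) auto
  have nonneg: "coeff ?p k \<ge> 0" for k
    using assms(2) by (simp add: coeff_hadamard)
  have "?p \<noteq> 0"
    using st by (auto simp: halfplane_stable_def cpoly_eq_0_iff)
  then have pos: "lead_coeff ?p > 0"
    using nonneg[of "degree ?p"] by (simp add: less_le)
  have "size {#u \<in># proots ?p. x \<le> u#} \<le>
      size {#v \<in># proots (hadamard (\<lambda>k. real (Suc k)) ?p). x \<le> v#}"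
  proof (rule hermite_biehler_count)
    show "halfplane_stable 1 (cpoly (hadamard (\<lambda>k. real (Suc k)) ?p) + smult \<i> (cpoly ?p))"
      using complex_zeros_nonneg_coeffs[OF st nonneg] \<open>?p \<noteq> 0\<close> by (rule stable_hadamard_Suc_add[rotated])
    show "lead_coeff (hadamard (\<lambda>k. real (Suc k)) ?p) > 0"
      by (rule lead_coeff_hadamard_pos[OF _ pos]) simp
  qed (rule pos)
  moreover have "hadamard (\<lambda>k. real (Suc k)) ?p = hadamard (\<lambda>k. real (Suc k) ^ Suc l) p"
    by (rule poly_eqI) (simp add: coeff_hadamard)
  ultimately show ?case
    using Suc.IH by (simp only:)
qed

section \<open>Location and interlacing of the zeros of super-Eulerian polynomials\<close>

lemma super_eulerian_poly_zeros:
  assumes "n \<ge> 1"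
  shows "complex_zeros (super_eulerian_poly l n) \<subseteq> complex_of_real ` {..0}"
  using stable_super_eulerian_poly[OF assms]
  by (rule complex_zeros_nonneg_coeffs) (simp add: coeff_super_eulerian_poly)

lemma real_rooted_super_eulerian_poly: "n \<ge> 1 \<Longrightarrow> real_rooted (super_eulerian_poly l n)"
  using stable_cpoly_imp_real_rooted stable_super_eulerian_poly .

lemma super_eulerian_poly_roots_neg:
  assumes "n \<ge> 1" "poly (super_eulerian_poly l n) x = 0"
  shows "x < 0"
proof -
  have "complex_of_real x \<in> complex_zeros (super_eulerian_poly l n)"
    using assms(2) by (simp add: complex_zeros_def poly_cpoly_of_real)
  then have "complex_of_real x \<in> complex_of_real ` {..0}"
    using super_eulerian_poly_zeros[OF assms(1)] by blast
  then have "x \<le> 0"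
    by auto
  moreover have "poly (super_eulerian_poly l n) 0 = 1"
    using assms(1) by (simp add: poly_0_coeff_0 coeff_super_eulerian_poly super_eulerian_0)
  ultimately show ?thesis
    using assms(2) by (cases "x = 0") auto
qed

lemma count_roots_super_eulerian_poly:
  assumes "n \<ge> 1"
  shows "size {#u \<in># proots (super_eulerian_poly l n). x \<le> u#} \<le>
    size {#v \<in># proots (super_eulerian_poly l (Suc n)). x \<le> v#}"
proof (rule order_trans)
  let ?p = "hadamard (\<lambda>k. real (Suc k) ^ l) (super_eulerian_poly l n)"
  show "size {#u \<in># proots (super_eulerian_poly l n). x \<le> u#} \<le> size {#v \<in># proots ?p. x \<le> v#}"
    using stable_super_eulerian_poly[OF assms]
    by (rule count_roots_hadamard_Suc_power) (simp add: coeff_super_eulerian_poly)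
  show "size {#v \<in># proots ?p. x \<le> v#} \<le> size {#v \<in># proots (super_eulerian_poly l (Suc n)). x \<le> v#}"
  proof (rule hermite_biehler_count[OF stable_super_eulerian_poly_Suc[OF assms]])
    show "lead_coeff ?p > 0"
      using lead_coeff_super_eulerian_poly[OF assms, of l] by (intro lead_coeff_hadamard_pos) simp_all
  qed (simp add: lead_coeff_super_eulerian_poly)
qed

lemma super_eulerian_poly_interlaces:
  assumes "n \<ge> 1"
  shows "super_eulerian_poly l n \<preceq> super_eulerian_poly l (n + 1)"
proof -
  let ?g = "super_eulerian_poly l n" and ?f = "super_eulerian_poly l (Suc n)"
  let ?u = "roots_desc ?g" and ?v = "roots_desc ?f"
  have rr: "real_rooted ?g" "real_rooted ?f"
    using assms by (simp_all add: real_rooted_super_eulerian_poly)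
  then have nz: "?g \<noteq> 0" "?f \<noteq> 0"
    by (simp_all add: real_rooted_imp_nonzero)
  have deg: "degree ?g = n - 1" "degree ?f = n"
    using assms by (simp_all add: degree_super_eulerian_poly)
  have neg: "poly ?g x = 0 \<Longrightarrow> x < 0" "poly ?f x = 0 \<Longrightarrow> x < 0" for x
    using assms super_eulerian_poly_roots_neg[of n l] super_eulerian_poly_roots_neg[of "Suc n" l]
    by auto
  have lower: "?u ! i \<le> ?v ! i" if "i < n - 1" for i
    using count_roots_super_eulerian_poly[OF assms] rr(1) that deg by (intro roots_desc_nth_le) auto
  have upper: "?v ! Suc i \<le> ?u ! i" if i: "Suc i < n" for i
  proof -
    \<comment> \<open>The mirror index of i among the n - 1 zeros of \<open>?g\<close>; among the n
      zeros of \<open>?f\<close> it mirrors i + 1. Inverting the inequality at j between negative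
      zeros gives the claim.\<close>
    define j where "j = n - 1 - Suc i"
    have j: "j < n - 1"
      using i by (simp add: j_def)
    have "n - 1 - Suc j = i" "n - Suc j = Suc i"
      using i by (simp_all add: j_def)
    then have eq: "?u ! i = inverse (?u ! j)" "?v ! Suc i = inverse (?v ! j)"
      using roots_desc_palindromic[of ?g j, OF reflect_super_eulerian_poly[OF assms] rr(1) neg(1)]
        roots_desc_palindromic[of ?f j, OF reflect_super_eulerian_poly rr(2) neg(2)] j deg by auto
    have "?v ! j \<in> set ?v"
      using j deg rr by (intro nth_mem) (simp add: length_roots_desc)
    then have "?v ! j < 0"
      using neg(2) nz by (simp add: set_roots_desc)
    then show ?thesis
      unfolding eq using lower[OF j] by (intro le_imp_inverse_le_neg)
  qed
  show ?thesis
    using rr nz deg lower upper lead_coeff_super_eulerian_poly[of n l] assms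
      lead_coeff_super_eulerian_poly[of "Suc n" l]
    by (simp add: interlaces_def Let_def)
qed

subsection \<open>Gamma expansions of palindromic polynomials\<close>

text \<open>For \<open>degree g \<le> d div 2\<close> this is (1 + t)^d g(t / (1 + t)^2), treated as
  a linear map in g.\<close>

definition gamma_sum :: "nat \<Rightarrow> real poly \<Rightarrow> real poly" where
  "gamma_sum d g = (\<Sum>i=0..d div 2. smult (coeff g i) (monom 1 i * [:1, 1:] ^ (d - 2 * i)))"

lemma gamma_expansion_iff: "gamma_expansion d p g \<longleftrightarrow> degree g \<le> d div 2 \<and> p = gamma_sum d g"
  by (simp add: gamma_expansion_def gamma_sum_def)

lemma gamma_sum_add: "gamma_sum d (g + h) = gamma_sum d g + gamma_sum d h"
  by (simp add: gamma_sum_def smult_add_left sum.distrib)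

lemma gamma_sum_diff: "gamma_sum d (g - h) = gamma_sum d g - gamma_sum d h"
  by (simp add: gamma_sum_def smult_diff_left sum_subtractf)

lemma gamma_sum_smult: "gamma_sum d (smult c g) = smult c (gamma_sum d g)"
  by (rule poly_eqI) (simp add: gamma_sum_def coeff_sum sum_distrib_left mult.assoc)

text \<open>For even d the index range is the same for d and d + 1; only each exponent of 1 + t
  grows by one.\<close>

lemma gamma_sum_Suc:
  assumes "even d"
  shows "gamma_sum (Suc d) g = [:1, 1:] * gamma_sum d g"
  unfolding gamma_sum_def sum_distrib_left
proof (rule sum.cong)
  fix i
  assume "i \<in> {0..d div 2}"
  then have "Suc d - 2 * i = Suc (d - 2 * i)"
    by auto
  then show "smult (coeff g i) (monom 1 i * [:1, 1:] ^ (Suc d - 2 * i)) =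
    [:1, 1:] * smult (coeff g i) (monom 1 i * [:1, 1:] ^ (d - 2 * i))"
    by (simp only: power_Suc mult_smult_right mult.left_commute)
qed (use assms in simp)

text \<open>The range gains one index, whose coefficient vanishes by the degree bound.\<close>

lemma gamma_sum_add_2:
  assumes "degree g \<le> d div 2"
  shows "gamma_sum (d + 2) g = [:1, 1:]\<^sup>2 * gamma_sum d g"
proof -
  have "gamma_sum (d + 2) g = (\<Sum>i=0..d div 2. smult (coeff g i) (monom 1 i * [:1, 1:] ^ (d + 2 - 2 * i)))"
    using assms by (simp add: gamma_sum_def coeff_eq_0)
  also have "\<dots> = [:1, 1:]\<^sup>2 * gamma_sum d g"
    unfolding gamma_sum_def sum_distrib_left
  proof (rule sum.cong)
    fix i
    assume "i \<in> {0..d div 2}"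
    then have "d + 2 - 2 * i = 2 + (d - 2 * i)"
      by auto
    then show "smult (coeff g i) (monom 1 i * [:1, 1:] ^ (d + 2 - 2 * i)) =
      [:1, 1:]\<^sup>2 * smult (coeff g i) (monom 1 i * [:1, 1:] ^ (d - 2 * i))"
      by (simp only: power_add mult_smult_right mult.left_commute)
  qed simp
  finally show ?thesis .
qed

lemma gamma_sum_pCons_0: "gamma_sum (d + 2) (pCons 0 g) = [:0, 1:] * gamma_sum d g"
proof -
  let ?s = "\<lambda>i. smult (coeff (pCons 0 g) i) (monom 1 i * [:1, 1:] ^ (d + 2 - 2 * i))"
  have "gamma_sum (d + 2) (pCons 0 g) = (\<Sum>i=0..Suc (d div 2). ?s i)"
    by (simp add: gamma_sum_def)
  also have "\<dots> = ?s 0 + (\<Sum>i=0..d div 2. (?s \<circ> Suc) i)"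
    by (simp only: sum.atLeast0_atMost_Suc_shift)
  also have "?s 0 = 0"
    by simp
  also have "(\<Sum>i=0..d div 2. (?s \<circ> Suc) i) = [:0, 1:] * gamma_sum d g"
    unfolding gamma_sum_def sum_distrib_left
  proof (rule sum.cong)
    fix i
    have "monom 1 (Suc i) = [:0, 1:] * monom (1::real) i"
      by (simp add: monom_Suc)
    then show "(?s \<circ> Suc) i = [:0, 1:] * smult (coeff g i) (monom 1 i * [:1, 1:] ^ (d - 2 * i))"
      by (simp only: o_def coeff_pCons_Suc mult_smult_right mult.assoc) simp
  qed simp
  finally show ?thesis
    by simp
qed

text \<open>The expansion is triangular: the i-th basis polynomial starts with t^i and coefficient
  1, so the coefficients of g vanish one after another.\<close>

lemma gamma_sum_eq_0_imp:
  assumes "gamma_sum d g = 0" "degree g \<le> d div 2"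
  shows "g = 0"
proof -
  have "coeff g i = 0" for i
  proof (induction i rule: less_induct)
    case (less i)
    show ?case
    proof (cases "i \<le> d div 2")
      case True
      have "coeff (smult (coeff g j) (monom 1 j * [:1, 1:] ^ (d - 2 * j))) i =
          (if j = i then coeff g i else 0)" for j
        using less.IH[of j] by (auto simp: coeff_monom_mult coeff_0_power)
      then have "coeff (gamma_sum d g) i = (\<Sum>j=0..d div 2. if j = i then coeff g i else 0)"
        unfolding gamma_sum_def coeff_sum by (intro sum.cong refl)
      then show ?thesis
        using True assms(1) by simp
    qed (use assms(2) in \<open>simp add: coeff_eq_0\<close>)
  qed
  then show ?thesis
    by (simp add: poly_eqI)
qed

lemma gamma_expansion_unique:
  assumes "gamma_expansion d p g" "gamma_expansion d p h"
  shows "g = h"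
proof -
  have "gamma_sum d (g - h) = 0" "degree (g - h) \<le> d div 2"
    using assms degree_diff_le[of g "d div 2" h] by (auto simp: gamma_expansion_iff gamma_sum_diff)
  then show ?thesis
    using gamma_sum_eq_0_imp by fastforce
qed

lemma gamma_poly_eq: "gamma_expansion d p g \<Longrightarrow> gamma_poly d p = g"
  unfolding gamma_poly_def using gamma_expansion_unique by blast

section \<open>Gamma expansions by splitting off palindromic factors\<close>

lemma palindromic_odd_root:
  fixes p :: "real poly"
  assumes "reflect_poly p = p" "odd (degree p)"
  shows "poly p (- 1) = 0"
  \<comment> \<open>Evaluating the reflection at -1 gives p(-1) = (-1)^d p(-1) with d odd.\<close>
  using poly_reflect_poly_nz[of "-1" p] assms by simp

lemma palindromic_factor:
  fixes a q :: "real poly"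
  assumes "reflect_poly (a * q) = a * q" "reflect_poly a = a" "a \<noteq> 0"
  shows "reflect_poly q = q"
  using assms by (simp add: reflect_poly_mult)

lemma real_rooted_linear: "real_rooted [:1, s:]"
proof -
  have "Im z = 0" if "1 + z * complex_of_real s = 0" for z
    using that by (cases "s = 0") (auto simp: complex_eq_iff)
  then show ?thesis
    by (auto simp: real_rooted_def complex_zeros_def complex_is_Real_iff cpoly_pCons)
qed

lemma palindromic_gamma_expansion:
  assumes "real_rooted p" "reflect_poly p = p" "\<And>x. poly p x = 0 \<Longrightarrow> x < 0" "lead_coeff p > 0"
  shows "\<exists>g. gamma_expansion (degree p) p g \<and> real_rooted g \<and> (\<forall>i. coeff g i \<ge> 0)"
  using assms
proof (induction "degree p" arbitrary: p rule: less_induct)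
  case less
  note refl = less.prems(2)
  have "p \<noteq> 0"
    using less.prems(4) by auto
  \<comment> \<open>All four assumptions pass to the cofactor of a palindromic factor, so the
    induction hypothesis applies to it.\<close>
  have factor: "\<exists>g. gamma_expansion (degree q) q g \<and> real_rooted g \<and> (\<forall>i. coeff g i \<ge> 0)"
    if "p = a * q" "reflect_poly a = a" "lead_coeff a > 0" "degree q < degree p" for a q
  proof (rule less.hyps)
    have "a \<noteq> 0"
      using that(3) by auto
    then show "reflect_poly q = q"
      using refl that palindromic_factor by metis
  qed (use less.prems that in \<open>auto simp: real_rooted_mult lead_coeff_mult zero_less_mult_iff\<close>)
  consider "degree p = 0" | "odd (degree p)" | "degree p > 0" "even (degree p)"
    by blast
  then show ?case
  proof cases
    case 1
    then obtain c where "p = [:c:]"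
      by (metis degree_eq_zeroE)
    then show ?thesis
      using less.prems by (intro exI[of _ p]) (auto simp: gamma_expansion_def monom_0 coeff_pCons split: nat.split)
  next
    case 2
    then obtain q where q: "p = [:1, 1:] * q"
      using palindromic_odd_root[OF refl] by (auto simp: poly_eq_0_iff_dvd dvd_def)
    then have deg: "degree p = Suc (degree q)"
      using \<open>p \<noteq> 0\<close> unfolding q by (subst degree_mult_eq) auto
    then obtain g where g: "gamma_expansion (degree q) q g" "real_rooted g" "\<forall>i. coeff g i \<ge> 0"
      using factor[OF q] by (auto simp: reflect_poly_pCons)
    have "even (degree q)"
      using 2 deg by simp
    then have "gamma_expansion (degree p) p g"
      using g(1) unfolding deg gamma_expansion_iff gamma_sum_Suc[OF \<open>even (degree q)\<close>]
      by (simp add: q del: mult_pCons_left)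
    then show ?thesis
      using g by blast
  next
    case 3
    obtain r where r: "poly p r = 0"
      using real_rooted_root[OF less.prems(1) 3(1)] .
    then have "r < 0"
      by (rule less.prems(3))
    obtain p' where p': "p = [:- r, 1:] * p'"
      using r by (auto simp: poly_eq_0_iff_dvd dvd_def)
    have deg': "degree p = Suc (degree p')"
      using \<open>p \<noteq> 0\<close> unfolding p' by (subst degree_mult_eq) auto
    \<comment> \<open>The partner 1/r must survive division by t - r. For r = -1 it is r itself, and
      the odd degree of the palindromic cofactor provides a second zero at -1.\<close>
    have "poly p' (inverse r) = 0"
    proof (cases "r = - 1")
      case True
      have "reflect_poly [:- r, 1:] = [:- r, 1:]"
        using True by (simp add: reflect_poly_pCons)
      then have "reflect_poly p' = p'"
        using refl unfolding p' by (intro palindromic_factor[of "[:- r, 1:]" p']) auto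
      moreover have "odd (degree p')"
        using 3 deg' by simp
      ultimately show ?thesis
        using True palindromic_odd_root by simp
    next
      case False
      have "poly p (inverse r) = 0"
        using poly_reflect_poly_nz[of "inverse r" p] refl r \<open>r < 0\<close> by simp
      moreover have "inverse r \<noteq> r"
      proof
        assume "inverse r = r"
        then have "r * r = 1"
          using \<open>r < 0\<close> by (simp add: field_simps)
        then show False
          using False \<open>r < 0\<close> square_eq_1_iff[of r] by auto
      qed
      ultimately show ?thesis
        unfolding p' by simp
    qed
    then obtain q where q': "p' = [:- inverse r, 1:] * q"
      by (auto simp: poly_eq_0_iff_dvd dvd_def)
    \<comment> \<open>Chosen so that (t - r)(t - 1/r) = (1 + t)^2 + s t; negativity of r gives s
      \<ge> 0.\<close>
    define s where "s = (r + 1)\<^sup>2 / (- r)"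
    have "s \<ge> 0"
      using \<open>r < 0\<close> by (simp add: s_def divide_nonneg_neg)
    have "- r - inverse r = s + 2"
      using \<open>r < 0\<close> by (simp add: s_def field_simps power2_eq_square)
    then have a: "[:- r, 1:] * [:- inverse r, 1:] = [:1, s + 2, 1:]"
      using \<open>r < 0\<close> by simp
    have q: "p = [:1, s + 2, 1:] * q"
      unfolding p' q' a[symmetric] by (simp only: mult.assoc)
    have deg: "degree p = degree q + 2"
      using \<open>p \<noteq> 0\<close> unfolding q by (subst degree_mult_eq) auto
    then obtain g where g: "gamma_expansion (degree q) q g" "real_rooted g" "\<forall>i. coeff g i \<ge> 0"
      using factor[OF q] by (auto simp: reflect_poly_pCons)
    have g': "[:1, s:] * g = g + smult s (pCons 0 g)"
      by simp
    have "degree g \<le> degree q div 2" "gamma_sum (degree q) g = q"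
      using g(1) by (auto simp: gamma_expansion_iff)
    \<comment> \<open>Multiplying g by 1 + s t multiplies the expanded polynomial by (1 + t)^2 + s
      t.\<close>
    then have "gamma_sum (degree q + 2) ([:1, s:] * g) = [:1, 1:]\<^sup>2 * q + smult s ([:0, 1:] * q)"
      unfolding g' gamma_sum_add gamma_sum_smult gamma_sum_pCons_0 by (simp only: gamma_sum_add_2)
    also have "\<dots> = ([:1, 1:]\<^sup>2 + smult s [:0, 1:]) * q"
      by (simp only: distrib_right mult_smult_left)
    also have "[:1, 1:]\<^sup>2 + smult s [:0, 1:] = [:1, s + 2, 1:]"
      by (simp add: power2_eq_square)
    finally have "p = gamma_sum (degree p) ([:1, s:] * g)"
      unfolding deg by (rule trans[OF q, OF sym])
    moreover have "degree ([:1, s:] * g) \<le> degree p div 2"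
      using g(1) by (intro order_trans[OF degree_mult_le]) (auto simp: gamma_expansion_iff deg)
    ultimately have "gamma_expansion (degree p) p ([:1, s:] * g)"
      by (simp only: gamma_expansion_iff simp_thms)
    moreover have "real_rooted ([:1, s:] * g)"
      using g(2) real_rooted_linear by (simp only: real_rooted_mult simp_thms)
    moreover have "coeff ([:1, s:] * g) i \<ge> 0" for i
      using g(3) \<open>s \<ge> 0\<close> by (auto simp: coeff_pCons split: nat.split)
    ultimately show ?thesis
      by blast
  qed
qed

theorem theorem5p1:
  fixes l n :: nat
  assumes "l \<ge> 1" and "n \<ge> 1"
  shows "(\<forall>z \<in> complex_zeros (super_eulerian_poly l n). z \<in> \<real> \<and> Re z \<le> 0) \<and>
    super_eulerian_poly l n \<preceq> super_eulerian_poly l (n + 1) \<and>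
    real_rooted (gamma_poly (n - 1) (super_eulerian_poly l n)) \<and>
    (\<forall>i. coeff (gamma_poly (n - 1) (super_eulerian_poly l n)) i \<ge> 0)"
proof (intro conjI)
  show "\<forall>z \<in> complex_zeros (super_eulerian_poly l n). z \<in> \<real> \<and> Re z \<le> 0"
    using super_eulerian_poly_zeros[OF assms(2), of l] by auto
  show "super_eulerian_poly l n \<preceq> super_eulerian_poly l (n + 1)"
    using assms(2) by (rule super_eulerian_poly_interlaces)
  \<comment> \<open>Uniqueness of the expansion identifies this g with the polynomial picked by
    \<open>gamma_poly\<close>.\<close>
  obtain g where g: "gamma_expansion (n - 1) (super_eulerian_poly l n) g" "real_rooted g"
    "\<forall>i. coeff g i \<ge> 0"
    using palindromic_gamma_expansion[of "super_eulerian_poly l n",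
        OF real_rooted_super_eulerian_poly[OF assms(2)] reflect_super_eulerian_poly[OF assms(2)]
          super_eulerian_poly_roots_neg[OF assms(2), of l] lead_coeff_super_eulerian_poly[OF assms(2)]] assms(2)
    by (auto simp: degree_super_eulerian_poly)
  then show "real_rooted (gamma_poly (n - 1) (super_eulerian_poly l n))"
    "\<forall>i. coeff (gamma_poly (n - 1) (super_eulerian_poly l n)) i \<ge> 0"
    by (simp_all add: gamma_poly_eq)
qed

end
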